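(* Let $\gamma>0$ and let $G\in C^2(\mathbb{R}^N;\mathbb{R})$ be a convex function such that $\operatorname{argmin}G=\{u\in\mathbb{R}^N;G(u)=\min G\}$ is nonempty. Assume further that for each minimizer $x^*$ of $G$ there exist $\eta>0$, $r\ge1$ and $c>0$ such that $$G(u)\ge\min G+c\,\operatorname{dist}(u,\operatorname{argmin}G)^r\quad\text{for every }u\in B(x^*,\eta).$$ Let $u\in C^2([0,\infty);\mathbb{R}^N)$ be a solution to $u''(t)+\gamma u'(t)+\nabla G(u(t))=0$, $t\ge0$. Then the curve $t\mapsto(u(t),u'(t))$ has finite length. In particular $u(t)$ converges to a minimizer $u_\infty$ of $G$ as $t\to\infty$.
   Context: $B(x^*,\eta)$ is the open Euclidean ball of center $x^*$ and radius $\eta$; $\operatorname{dist}$ is the Euclidean distance to a set. *)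

theory Defs
  imports "HOL-Analysis.Analysis"
begin

definition argmin :: "('a \<Rightarrow> real) \<Rightarrow> 'a set" where
  "argmin G = {x. is_arg_min G (\<lambda>_. True) x}"

text \<open>Length as the supremum, in \<open>[0, \<infinity>]\<close>, of the lengths of inscribed polygons.  The
  parameter set \<open>S\<close> may be unbounded, and a sorted list enumerates the vertices of a polygon;
  the empty list contributes \<open>0\<close>.\<close>

definition curve_length :: "real set \<Rightarrow> (real \<Rightarrow> 'a::metric_space) \<Rightarrow> ennreal" where
  "curve_length S f =
     (SUP ts \<in> {ts. sorted ts \<and> set ts \<subseteq> S}.
        \<Sum>i<length ts - 1. ennreal (dist (f (ts ! i)) (f (ts ! Suc i))))"

end

theory Submission
  imports Defs
begin

text \<open>Convexity alone gives convergence: for a minimizer \<open>z\<close> the quantity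
  \<open>d/dt (\<bar>u - z\<bar>\<^sup>2 / 2) + \<gamma> \<bar>u - z\<bar>\<^sup>2 / 2\<close> plus \<open>2 / \<gamma>\<close> times the energy is nonincreasing and
  dissipates the energy.  So the energy is \<open>O(1 / t)\<close>, \<open>\<bar>u - z\<bar>\<close> converges for every
  minimizer \<open>z\<close>, and any limit point of \<open>u\<close>, being a minimizer, is the limit.

  Near the limit, convexity turns the growth condition into an inequality of Lojasiewicz
  type \<open>G - min G \<le> (k \<bar>\<nabla>G\<bar>) powr (q / (q - 1))\<close> with \<open>q \<ge> 2\<close>.  The perturbed energy
  \<open>P = \<bar>u'\<bar>\<^sup>2 / 2 + G(u) - min G + \<epsilon> \<langle>\<nabla>G(u), u'\<rangle>\<close> satisfies
  \<open>P' \<le> - b (\<bar>u'\<bar>\<^sup>2 + \<bar>\<nabla>G(u)\<bar>\<^sup>2)\<close> and \<open>P powr (1 - 1 / q) \<le> D (\<bar>u'\<bar> + \<bar>\<nabla>G(u)\<bar>)\<close>, so a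
  multiple of \<open>P powr (1 / q)\<close> decreases at least as fast as the arc length of \<open>(u, u')\<close> grows.\<close>

section \<open>Length of a curve and estimates from one-sided derivatives\<close>

lemma mem_argmin_iff: "z \<in> argmin G \<longleftrightarrow> (\<forall>x. G z \<le> G x)" for G :: "'a \<Rightarrow> real"
  by (simp add: argmin_def is_arg_min_linorder)

text \<open>\<open>V\<close> acts as an arc-length function: the sum over any inscribed polygon is
  dominated by a telescoping sum of increments of \<open>V\<close>, hence by the range of
  \<open>V\<close>.\<close>

lemma curve_length_le:
  fixes V :: "real \<Rightarrow> real"
  assumes dist_le: "\<And>s t. s \<in> S \<Longrightarrow> t \<in> S \<Longrightarrow> s \<le> t \<Longrightarrow> dist (f s) (f t) \<le> V t - V s"
    and V_ge: "\<And>t. t \<in> S \<Longrightarrow> a \<le> V t"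
    and V_le: "\<And>t. t \<in> S \<Longrightarrow> V t \<le> b"
  shows "curve_length S f \<le> ennreal (b - a)"
  unfolding curve_length_def
proof (rule SUP_least, clarify)
  fix ts :: "real list"
  assume sorted: "sorted ts" and sub: "set ts \<subseteq> S"
  show "(\<Sum>i<length ts - 1. ennreal (dist (f (ts ! i)) (f (ts ! Suc i)))) \<le> ennreal (b - a)"
  \<comment> \<open>Subtraction is truncated, so this case covers both the empty list and a single
    vertex; the sum is then empty.\<close>
  proof (cases "length ts - 1 = 0")
    case False
    then have mem: "ts ! i \<in> S" if "i \<le> length ts - 1" for i
      using sub that by (intro subsetD[OF sub] nth_mem) auto
    have "(\<Sum>i<length ts - 1. dist (f (ts ! i)) (f (ts ! Suc i)))
        \<le> (\<Sum>i<length ts - 1. V (ts ! Suc i) - V (ts ! i))"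
      using sorted by (intro sum_mono dist_le mem) (auto simp: sorted_iff_nth_mono)
    also have "\<dots> = V (ts ! (length ts - 1)) - V (ts ! 0)"
      by (rule sum_lessThan_telescope)
    also have "\<dots> \<le> b - a"
      by (intro diff_mono V_le V_ge mem) auto
    finally show ?thesis
      by (simp add: sum_ennreal ennreal_leI)
  qed simp
qed

text \<open>A mean value inequality on a half-line. The derivative is one-sided only at
  \<open>a\<close>; at points beyond \<open>s\<close> it is two-sided, which reduces the claim to
  the version on an open interval.\<close>

lemma norm_diff_le_of_derivative_within:
  fixes f :: "real \<Rightarrow> 'a::real_normed_vector" and \<phi> :: "real \<Rightarrow> real"
  assumes f: "\<And>t. t \<ge> a \<Longrightarrow> (f has_vector_derivative f' t) (at t within {a..})"
    and \<phi>: "\<And>t. t \<ge> a \<Longrightarrow> (\<phi> has_real_derivative \<phi>' t) (at t within {a..})"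
    and "a \<le> s" "s \<le> t"
    and le: "\<And>x. s < x \<Longrightarrow> x < t \<Longrightarrow> norm (f' x) \<le> \<phi>' x"
  shows "norm (f t - f s) \<le> \<phi> t - \<phi> s"
proof (cases "s = t")
  case False
  have cont_f: "continuous_on {a..} f"
    using f by (auto intro!: has_vector_derivative_continuous simp: continuous_on_eq_continuous_within)
  have cont_\<phi>: "continuous_on {a..} \<phi>"
    using \<phi> by (auto intro!: DERIV_continuous simp: continuous_on_eq_continuous_within)
  have at_eq: "at x within {a..} = at x" if "s < x" for x
    using that \<open>a \<le> s\<close> by (intro at_within_interior) auto
  show ?thesis
  proof (rule differentiable_bound_general)
    show "s < t" using False \<open>s \<le> t\<close> by simp
    show "continuous_on {s..t} f" "continuous_on {s..t} \<phi>"
      using \<open>a \<le> s\<close> by (auto intro: continuous_on_subset[OF cont_f] continuous_on_subset[OF cont_\<phi>])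
    fix x assume x: "s < x" "x < t"
    then have "a \<le> x" using \<open>a \<le> s\<close> by simp
    with x show "(f has_vector_derivative f' x) (at x)" "(\<phi> has_vector_derivative \<phi>' x) (at x)"
        "norm (f' x) \<le> \<phi>' x"
      using f[of x] \<phi>[of x] le[OF x] at_eq[OF x(1)]
      by (simp_all add: has_real_derivative_iff_has_vector_derivative)
  qed
qed simp

lemma nonincreasing_of_derivative_within:
  fixes f :: "real \<Rightarrow> real"
  assumes f: "\<And>t. t \<ge> a \<Longrightarrow> (f has_real_derivative f' t) (at t within {a..})"
    and le: "\<And>t. t \<ge> a \<Longrightarrow> f' t \<le> 0"
    and "a \<le> s" "s \<le> t"
  shows "f t \<le> f s"
proof -
  \<comment> \<open>The zero function with majorant \<open>- f\<close> turns the mean value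
    inequality into monotonicity.\<close>
  have "norm ((0::real) - 0) \<le> (- f t) - (- f s)"
    by (rule norm_diff_le_of_derivative_within[where a = a and f' = "\<lambda>_. 0" and \<phi>' = "\<lambda>t. - f' t"])
      (use assms in \<open>auto intro: DERIV_minus\<close>)
  then show ?thesis by simp
qed

lemma nonincreasing_bounded_below_convergent:
  fixes f :: "real \<Rightarrow> real"
  assumes mono: "\<And>s t. a \<le> s \<Longrightarrow> s \<le> t \<Longrightarrow> f t \<le> f s"
    and below: "\<And>t. a \<le> t \<Longrightarrow> b \<le> f t"
  shows "\<exists>l. (f \<longlongrightarrow> l) at_top"
proof
  have bdd: "bdd_below (f ` {a..})"
    using below by (auto intro!: bdd_belowI)
  show "(f \<longlongrightarrow> Inf (f ` {a..})) at_top"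
  proof (rule decreasing_tendsto)
    show "\<forall>\<^sub>F t in at_top. Inf (f ` {a..}) \<le> f t"
      using eventually_ge_at_top[of a] by eventually_elim (auto intro: cInf_lower bdd)
    fix x assume "Inf (f ` {a..}) < x"
    then obtain s where s: "s \<ge> a" "f s < x"
      using cInf_less_iff[OF _ bdd] by auto
    show "\<forall>\<^sub>F t in at_top. f t < x"
      using eventually_ge_at_top[of s] by eventually_elim (use s mono in \<open>fastforce\<close>)
  qed
qed

section \<open>Convexity, nearest minimizers and the gradient inequality\<close>

text \<open>Restricting \<open>G\<close> to the line through \<open>x\<close> and \<open>y\<close>
  reduces this to the tangent inequality for a convex function of one variable, with tangent at 0
  and evaluation at 1.\<close>

lemma convex_on_above_gradient:
  fixes G :: "'a::real_inner \<Rightarrow> real"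
  assumes "convex_on UNIV G" "GDERIV G x :> g"
  shows "g \<bullet> (y - x) \<le> G y - G x"
proof -
  define \<phi> where "\<phi> = (\<lambda>s. G (x + s *\<^sub>R (y - x)))"
  have conv: "convex_on UNIV \<phi>"
  proof (intro convex_onI)
    fix t a b :: real assume t: "0 < t" "t < 1"
    have "G ((1 - t) *\<^sub>R (x + a *\<^sub>R (y - x)) + t *\<^sub>R (x + b *\<^sub>R (y - x)))
        \<le> (1 - t) * \<phi> a + t * \<phi> b"
      unfolding \<phi>_def using t by (intro convex_onD[OF assms(1)]) auto
    moreover have "(1 - t) *\<^sub>R (x + a *\<^sub>R (y - x)) + t *\<^sub>R (x + b *\<^sub>R (y - x))
        = x + ((1 - t) *\<^sub>R a + t *\<^sub>R b) *\<^sub>R (y - x)"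
      by (simp add: algebra_simps)
    ultimately show "\<phi> ((1 - t) *\<^sub>R a + t *\<^sub>R b) \<le> (1 - t) * \<phi> a + t * \<phi> b"
      by (simp add: \<phi>_def)
  qed simp
  have "((\<lambda>s. x + s *\<^sub>R (y - x)) has_derivative (\<lambda>s. s *\<^sub>R (y - x))) (at (0::real))"
    by (auto intro!: derivative_eq_intros)
  from has_derivative_compose[OF this, of G "\<lambda>h. h \<bullet> g"] assms(2)
  have "(\<phi> has_real_derivative g \<bullet> (y - x)) (at 0)"
    by (simp add: \<phi>_def gderiv_def has_field_derivative_def inner_commute mult_commute_abs)
  from convex_on_imp_above_tangent[OF conv _ _ _ this, of 1] show ?thesis
    by (simp add: \<phi>_def)
qed

lemma gradient_eq_0_of_argmin:
  fixes G :: "'a::real_inner \<Rightarrow> real"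
  assumes "GDERIV G z :> g" "z \<in> argmin G"
  shows "g = 0"
proof -
  have "(\<lambda>h. h \<bullet> g) = (\<lambda>h. 0)"
    using assms by (intro differential_zero_maxmin[of z UNIV G]) (auto simp: gderiv_def mem_argmin_iff)
  then show ?thesis
    by (metis inner_eq_zero_iff)
qed

text \<open>The minimizers form a closed sublevel set, so a nearest one exists; the tangent
  inequality at \<open>w\<close> is tested against it.\<close>

lemma convex_gap_le_gradient_infdist:
  fixes G :: "'a::euclidean_space \<Rightarrow> real"
  assumes conv: "convex_on UNIV G"
    and grad: "\<And>x. GDERIV G x :> gradG x"
    and z: "z \<in> argmin G"
  shows "G w - G z \<le> norm (gradG w) * infdist w (argmin G)"
proof -
  have contG: "continuous_on UNIV G"
    using grad by (auto simp: gderiv_def continuous_on_eq_continuous_within intro: has_derivative_continuous)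
  have "argmin G = {x. G x \<le> G z}"
    using z order_trans by (fastforce simp: mem_argmin_iff)
  then have "closed (argmin G)"
    using contG by (auto intro!: closed_Collect_le continuous_intros)
  then obtain p where p: "p \<in> argmin G" "infdist w (argmin G) = dist w p"
    using z by (metis infdist_attains_inf empty_iff)
  have "G p = G z"
    using p z by (auto simp: mem_argmin_iff intro: antisym)
  then have "G w - G z \<le> gradG w \<bullet> (w - p)"
    using convex_on_above_gradient[OF conv grad, of w p] by (simp add: inner_diff_right)
  also have "\<dots> \<le> norm (gradG w) * dist w p"
    by (simp add: dist_norm norm_cauchy_schwarz)
  finally show ?thesis using p by simp
qed

text \<open>With \<open>F\<close> the gap and \<open>D\<close> the distance to the minimizers,
  growth gives \<open>D \<le> k * F powr (1 / q)\<close>, while convexity gives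
  \<open>F \<le> norm (gradG w) * D\<close>. Eliminating \<open>D\<close> leaves a bound on
  \<open>F powr (1 - 1 / q)\<close>.\<close>

lemma growth_imp_gradient_inequality:
  fixes G :: "'a::euclidean_space \<Rightarrow> real"
  assumes conv: "convex_on UNIV G"
    and grad: "\<And>x. GDERIV G x :> gradG x"
    and z: "z \<in> argmin G"
    and pos: "\<eta> > 0" "c > 0"
    and growth: "\<And>w. w \<in> ball z \<eta> \<Longrightarrow> G w \<ge> G z + c * infdist w (argmin G) powr r"
  obtains \<delta> q k where "\<delta> > 0" "q \<ge> 2" "k > 0"
    "\<And>w. w \<in> ball z \<delta> \<Longrightarrow> G w - G z \<le> (k * norm (gradG w)) powr (q / (q - 1))"
proof
  \<comment> \<open>Near \<open>z\<close> the distance is below 1, so the exponent may be raised to at least 2.\<close>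
  define q where "q = max r 2"
  define k where "k = (1 / c) powr (1 / q)"
  show "min \<eta> 1 > 0" "q \<ge> 2" "k > 0"
    using pos by (auto simp: q_def k_def)
  fix w assume w: "w \<in> ball z (min \<eta> 1)"
  define D where "D = infdist w (argmin G)"
  define F where "F = G w - G z"
  have "D \<le> dist w z"
    unfolding D_def by (rule infdist_le[OF z])
  then have D: "0 \<le> D" "D \<le> 1"
    using w by (auto simp: D_def dist_commute infdist_nonneg)
  have "D powr q \<le> D powr r"
    using D by (cases "D = 0") (auto intro!: powr_mono' simp: q_def)
  then have "c * D powr q \<le> c * D powr r"
    using pos by simp
  also have "\<dots> \<le> F"
    using growth[of w] w by (simp add: D_def F_def)
  finally have low: "D powr q \<le> F / c"
    using pos by (simp add: field_simps)
  have up: "F \<le> norm (gradG w) * D"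
    unfolding D_def F_def by (rule convex_gap_le_gradient_infdist[OF conv grad z])
  show "G w - G z \<le> (k * norm (gradG w)) powr (q / (q - 1))"
  proof (cases "F > 0")
    case False
    then show ?thesis
      using powr_ge_zero[of "k * norm (gradG w)" "q / (q - 1)"] unfolding F_def by linarith
  next
    case True
    have q: "q \<ge> 2" by (simp add: q_def)
    have "D = (D powr q) powr (1 / q)"
      using D q by (simp add: powr_powr)
    also have "\<dots> \<le> (F / c) powr (1 / q)"
      using low q by (intro powr_mono2) auto
    also have "\<dots> = k * F powr (1 / q)"
      using pos True by (simp add: k_def powr_divide)
    finally have "F \<le> norm (gradG w) * (k * F powr (1 / q))"
      using up by (meson mult_left_mono norm_ge_zero order_trans)
    then have "F * F powr (- (1 / q)) \<le> norm (gradG w) * (k * F powr (1 / q)) * F powr (- (1 / q))"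
      by (intro mult_right_mono) auto
    also have "\<dots> = k * norm (gradG w)"
      using True by (simp add: powr_minus field_simps)
    also have "F * F powr (- (1 / q)) = F powr ((q - 1) / q)"
      using True q by (simp add: powr_mult_base diff_divide_distrib)
    finally have "(F powr ((q - 1) / q)) powr (q / (q - 1)) \<le> (k * norm (gradG w)) powr (q / (q - 1))"
      using q by (intro powr_mono2) auto
    then show ?thesis
      using True q by (simp add: powr_powr F_def)
  qed
qed

section \<open>Derivatives along the damped flow and decay of the energy\<close>

lemma inner_has_real_derivative:
  assumes "(f has_vector_derivative f') (at t within S)" "(g has_vector_derivative g') (at t within S)"
  shows "((\<lambda>t. f t \<bullet> g t) has_real_derivative f t \<bullet> g' + f' \<bullet> g t) (at t within S)"
  using bounded_bilinear.has_vector_derivative[OF bounded_bilinear_inner assms]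
  by (simp add: has_real_derivative_iff_has_vector_derivative)

text \<open>The second-order equation is recast as a first-order system for \<open>(u, v)\<close>.
  The Hessian takes values in bounded linear maps, so its continuity is in operator norm.\<close>

locale damped_gradient_flow =
  fixes \<gamma> :: real
    and G :: "'a::euclidean_space \<Rightarrow> real"
    and gradG :: "'a \<Rightarrow> 'a"
    and hessG :: "'a \<Rightarrow> 'a \<Rightarrow>\<^sub>L 'a"
    and u v :: "real \<Rightarrow> 'a"
  assumes gamma_pos: "\<gamma> > 0"
    and grad: "\<And>x. GDERIV G x :> gradG x"
    and hess: "\<And>x. (gradG has_derivative blinfun_apply (hessG x)) (at x)"
    and cont_hess: "continuous_on UNIV hessG"
    and conv: "convex_on UNIV G"
    and u_deriv: "\<And>t. t \<ge> 0 \<Longrightarrow> (u has_vector_derivative v t) (at t within {0..})"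
    and v_deriv: "\<And>t. t \<ge> 0 \<Longrightarrow>
      (v has_vector_derivative - (\<gamma> *\<^sub>R v t) - gradG (u t)) (at t within {0..})"
begin

lemma cont_G: "continuous_on UNIV G"
  using grad by (auto simp: gderiv_def continuous_on_eq_continuous_within intro: has_derivative_continuous)

lemma cont_gradG: "continuous_on UNIV gradG"
  using hess by (auto simp: continuous_on_eq_continuous_within intro: has_derivative_continuous)

lemma cont_u: "continuous_on {0..} u"
  using u_deriv by (auto intro!: has_vector_derivative_continuous simp: continuous_on_eq_continuous_within)

lemma cont_v: "continuous_on {0..} v"
  using v_deriv by (auto intro!: has_vector_derivative_continuous simp: continuous_on_eq_continuous_within)

lemma G_u_deriv:
  assumes "t \<ge> 0"
  shows "((\<lambda>t. G (u t)) has_real_derivative gradG (u t) \<bullet> v t) (at t within {0..})"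
  using has_derivative_compose[OF u_deriv[OF assms, unfolded has_vector_derivative_def]
      grad[unfolded gderiv_def]]
  by (simp add: has_field_derivative_def inner_commute mult_commute_abs)

lemma gradG_u_deriv:
  assumes "t \<ge> 0"
  shows "((\<lambda>t. gradG (u t)) has_vector_derivative hessG (u t) (v t)) (at t within {0..})"
  using has_derivative_compose[OF u_deriv[OF assms, unfolded has_vector_derivative_def] hess]
  by (simp add: has_vector_derivative_def blinfun.scaleR_right)

definition energy :: "'a \<Rightarrow> real \<Rightarrow> real" where
  "energy z t = (v t \<bullet> v t) / 2 + (G (u t) - G z)"

text \<open>Inserting the equation cancels the gradient terms, and only friction remains.\<close>

lemma energy_deriv:
  assumes "t \<ge> 0"
  shows "(energy z has_real_derivative - \<gamma> * (v t \<bullet> v t)) (at t within {0..})"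
  unfolding energy_def[abs_def]
  by (rule DERIV_cong[OF DERIV_add[OF
        DERIV_cdivide[OF inner_has_real_derivative[OF v_deriv v_deriv, OF assms assms]]
        DERIV_diff[OF G_u_deriv[OF assms] DERIV_const]]])
    (simp add: inner_diff_left inner_diff_right inner_commute[of "v t" "gradG (u t)"] field_simps)

lemma energy_nonneg: "z \<in> argmin G \<Longrightarrow> 0 \<le> energy z t"
  by (auto simp: energy_def mem_argmin_iff)

text \<open>The derivative of \<open>\<bar>u - z\<bar>\<^sup>2 / 2\<close> plus \<open>\<gamma>\<close> times it, corrected by enough
  energy to absorb the kinetic term in its derivative and still dissipate the energy.\<close>

definition anchored_energy :: "'a \<Rightarrow> real \<Rightarrow> real" where
  "anchored_energy z t =
     v t \<bullet> (u t - z) + \<gamma> / 2 * ((u t - z) \<bullet> (u t - z)) + 2 / \<gamma> * energy z t"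

text \<open>The friction part of the derivative of \<open>v t \<bullet> (u t - z)\<close> cancels
  against the quadratic term. That derivative also contains \<open>+ v t \<bullet> v t\<close>; the
  weight \<open>2 / \<gamma>\<close> on the energy contributes
  \<open>- 2 * (v t \<bullet> v t)\<close> and reverses its sign.\<close>

lemma anchored_energy_deriv:
  assumes "t \<ge> 0"
  shows "(anchored_energy z has_real_derivative - (v t \<bullet> v t) - gradG (u t) \<bullet> (u t - z))
    (at t within {0..})"
proof -
  have w: "((\<lambda>t. u t - z) has_vector_derivative v t) (at t within {0..})"
    using has_vector_derivative_diff_const[of u z] u_deriv[OF assms] by simp
  show ?thesis
    unfolding anchored_energy_def[abs_def]
    by (rule DERIV_cong[OF DERIV_add[OF DERIV_add[OF inner_has_real_derivative[OF v_deriv[OF assms] w]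
          DERIV_cmult[OF inner_has_real_derivative[OF w w]]]
        DERIV_cmult[OF energy_deriv[OF assms]]]])
      (use gamma_pos in \<open>simp add: inner_diff_left inner_commute algebra_simps\<close>)
qed

lemma anchored_energy_deriv_le:
  assumes z: "z \<in> argmin G"
  shows "- (v t \<bullet> v t) - gradG (u t) \<bullet> (u t - z) \<le> - energy z t"
proof -
  have "G (u t) - G z \<le> gradG (u t) \<bullet> (u t - z)"
    using convex_on_above_gradient[OF conv grad, of "u t" z] by (simp add: inner_diff_right)
  then show ?thesis
    using inner_ge_zero[of "v t"] unfolding energy_def by linarith
qed

text \<open>Completing the square: the kinetic term, of weight \<open>1 / \<gamma>\<close>, absorbs
  the indefinite product \<open>v t \<bullet> (u t - z)\<close> at the cost of half of the quadratic
  term.\<close>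

lemma anchored_energy_ge:
  assumes z: "z \<in> argmin G"
  shows "\<gamma> / 4 * (norm (u t - z))\<^sup>2 \<le> anchored_energy z t"
proof -
  let ?w = "u t - z"
  have "0 \<le> (2 *\<^sub>R v t + \<gamma> *\<^sub>R ?w) \<bullet> (2 *\<^sub>R v t + \<gamma> *\<^sub>R ?w) / (4 * \<gamma>)"
    using gamma_pos by simp
  also have "\<dots> = (v t \<bullet> v t) / \<gamma> + v t \<bullet> ?w + \<gamma> / 4 * (?w \<bullet> ?w)"
  proof -
    have "(2 *\<^sub>R v t + \<gamma> *\<^sub>R ?w) \<bullet> (2 *\<^sub>R v t + \<gamma> *\<^sub>R ?w)
        = 4 * (v t \<bullet> v t) + 4 * \<gamma> * (v t \<bullet> ?w) + \<gamma> * \<gamma> * (?w \<bullet> ?w)"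
      by (simp add: inner_add_left inner_add_right inner_commute algebra_simps)
    then show ?thesis using gamma_pos by (simp add: field_simps)
  qed
  finally have "0 \<le> (v t \<bullet> v t) / \<gamma> + v t \<bullet> ?w + \<gamma> / 4 * (?w \<bullet> ?w)" .
  moreover have "0 \<le> 2 / \<gamma> * (G (u t) - G z)"
    using gamma_pos z by (auto simp: mem_argmin_iff)
  moreover have "2 / \<gamma> * energy z t = (v t \<bullet> v t) / \<gamma> + 2 / \<gamma> * (G (u t) - G z)"
    by (simp add: energy_def distrib_left)
  ultimately show ?thesis
    unfolding anchored_energy_def power2_norm_eq_inner by linarith
qed

lemma anchored_energy_nonincreasing:
  assumes z: "z \<in> argmin G" and "0 \<le> s" "s \<le> t"
  shows "anchored_energy z t \<le> anchored_energy z s"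
proof (rule nonincreasing_of_derivative_within[OF anchored_energy_deriv _ assms(2,3)])
  show "- (v t \<bullet> v t) - gradG (u t) \<bullet> (u t - z) \<le> 0" for t
    using anchored_energy_deriv_le[OF z, of t] energy_nonneg[OF z, of t] by linarith
qed

lemma anchored_energy_nonneg: "z \<in> argmin G \<Longrightarrow> 0 \<le> anchored_energy z t"
  using gamma_pos by (rule_tac order_trans[OF _ anchored_energy_ge]) auto

text \<open>In the derivative of \<open>t * energy z t + anchored_energy z t\<close>, the term
  \<open>energy z t\<close> from the product rule is compensated by the dissipation of the anchored
  energy. At time 0 only \<open>anchored_energy z 0\<close> is left.\<close>

lemma energy_le:
  assumes z: "z \<in> argmin G" and t: "t > 0"
  shows "energy z t \<le> anchored_energy z 0 / t"
proof -
  let ?f = "\<lambda>t. t * energy z t + anchored_energy z t"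
  have "?f t \<le> ?f 0"
  proof (rule nonincreasing_of_derivative_within[where f = ?f and a = 0])
    fix s :: real assume s: "0 \<le> s"
    show "(?f has_real_derivative energy z s + s * (- \<gamma> * (v s \<bullet> v s))
        + (- (v s \<bullet> v s) - gradG (u s) \<bullet> (u s - z))) (at s within {0..})"
      using DERIV_add[OF DERIV_mult[OF DERIV_ident energy_deriv[OF s]] anchored_energy_deriv[OF s]]
      by (simp add: mult.commute)
    have "s * (- \<gamma> * (v s \<bullet> v s)) \<le> 0"
      using s gamma_pos by (simp add: mult_nonneg_nonneg)
    then show "energy z s + s * (- \<gamma> * (v s \<bullet> v s))
        + (- (v s \<bullet> v s) - gradG (u s) \<bullet> (u s - z)) \<le> 0"
      using anchored_energy_deriv_le[OF z, of s] by linarith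
  qed (use t in auto)
  then show ?thesis
    using anchored_energy_nonneg[OF z, of t] t by (simp add: field_simps)
qed

section \<open>Asymptotics of the trajectory and convergence to a minimizer\<close>

lemma energy_tendsto_0:
  assumes z: "z \<in> argmin G"
  shows "(energy z \<longlongrightarrow> 0) at_top"
proof (rule tendsto_sandwich)
  show "\<forall>\<^sub>F t in at_top. 0 \<le> energy z t"
    by (simp add: energy_nonneg[OF z])
  show "\<forall>\<^sub>F t in at_top. energy z t \<le> anchored_energy z 0 / t"
    using eventually_gt_at_top[of 0] by eventually_elim (rule energy_le[OF z])
  show "((\<lambda>t. anchored_energy z 0 / t) \<longlongrightarrow> 0) at_top"
    by (intro tendsto_divide_0[OF tendsto_const] filterlim_at_top_imp_at_infinity filterlim_ident)
qed simp

lemma G_u_tendsto: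
  assumes z: "z \<in> argmin G"
  shows "((\<lambda>t. G (u t)) \<longlongrightarrow> G z) at_top"
proof -
  have "((\<lambda>t. G (u t) - G z) \<longlongrightarrow> 0) at_top"
    by (rule tendsto_sandwich[OF _ _ tendsto_const energy_tendsto_0[OF z]])
      (use z in \<open>auto simp: energy_def mem_argmin_iff\<close>)
  then show ?thesis by (simp add: LIM_zero_iff)
qed

lemma v_tendsto_0:
  assumes z: "z \<in> argmin G"
  shows "(v \<longlongrightarrow> 0) at_top"
proof -
  have "((\<lambda>t. sqrt (2 * energy z t)) \<longlongrightarrow> 0) at_top"
    by (rule tendsto_eq_intros energy_tendsto_0[OF z] refl)+ simp
  moreover have "norm (v t) \<le> sqrt (2 * energy z t)" for t
    using z by (auto simp: norm_eq_sqrt_inner energy_def mem_argmin_iff)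
  ultimately show ?thesis
    by (rule_tac Lim_null_comparison) auto
qed

lemma bounded_u:
  assumes z: "z \<in> argmin G"
  shows "bounded (u ` {0..})"
proof -
  have "norm (u t - z) \<le> sqrt (4 / \<gamma> * anchored_energy z 0)" if "t \<ge> 0" for t
    using anchored_energy_ge[OF z, of t] anchored_energy_nonincreasing[OF z, of 0 t] that gamma_pos
    by (intro real_le_rsqrt) (simp add: field_simps)
  then have "u ` {0..} \<subseteq> cball z (sqrt (4 / \<gamma> * anchored_energy z 0))"
    by (auto simp: dist_norm norm_minus_commute)
  then show ?thesis
    using bounded_cball bounded_subset by blast
qed

text \<open>The anchored energy converges by monotonicity, and its other two terms vanish in the
  limit, so the quadratic term converges.\<close>

lemma norm_diff_convergent:
  assumes z: "z \<in> argmin G"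
  shows "\<exists>l. ((\<lambda>t. norm (u t - z)) \<longlongrightarrow> l) at_top"
proof -
  obtain l where l: "(anchored_energy z \<longlongrightarrow> l) at_top"
    using nonincreasing_bounded_below_convergent[of 0 "anchored_energy z" 0]
      anchored_energy_nonincreasing[OF z] anchored_energy_nonneg[OF z] by blast
  obtain B where B: "\<And>t. t \<ge> 0 \<Longrightarrow> norm (u t) \<le> B"
    using bounded_u[OF z] by (auto simp: bounded_iff)
  have "((\<lambda>t. v t \<bullet> (u t - z)) \<longlongrightarrow> 0) at_top"
  proof (rule Lim_null_comparison)
    show "\<forall>\<^sub>F t in at_top. norm (v t \<bullet> (u t - z)) \<le> norm (v t) * (B + norm z)"
      using eventually_ge_at_top[of 0]
    proof eventually_elim
      fix t :: real assume "0 \<le> t"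
      then have "norm (u t - z) \<le> B + norm z"
        using B[of t] norm_triangle_ineq4[of "u t" z] by linarith
      then show "norm (v t \<bullet> (u t - z)) \<le> norm (v t) * (B + norm z)"
        using Cauchy_Schwarz_ineq2[of "v t" "u t - z"]
          mult_left_mono[of "norm (u t - z)" "B + norm z" "norm (v t)"]
        by simp
    qed
    show "((\<lambda>t. norm (v t) * (B + norm z)) \<longlongrightarrow> 0) at_top"
      by (rule tendsto_eq_intros v_tendsto_0[OF z] refl)+ simp
  qed
  then have "((\<lambda>t. sqrt (2 / \<gamma> * (anchored_energy z t - v t \<bullet> (u t - z) - 2 / \<gamma> * energy z t)))
      \<longlongrightarrow> sqrt (2 / \<gamma> * (l - 0 - 2 / \<gamma> * 0))) at_top"
    by (intro tendsto_intros l energy_tendsto_0[OF z])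
  moreover have "sqrt (2 / \<gamma> * (anchored_energy z t - v t \<bullet> (u t - z) - 2 / \<gamma> * energy z t))
      = norm (u t - z)" for t
    using gamma_pos by (simp add: anchored_energy_def norm_eq_sqrt_inner)
  ultimately show ?thesis by auto
qed

text \<open>Opial's argument: a limit along integer times is a minimizer, so the distance to it has
  a limit, which the subsequence identifies as 0.\<close>

lemma u_tendsto_argmin:
  assumes "argmin G \<noteq> {}"
  obtains x where "x \<in> argmin G" "(u \<longlongrightarrow> x) at_top"
proof -
  obtain z where z: "z \<in> argmin G" using assms by auto
  have "bounded (range (\<lambda>n. u (real n)))"
    by (rule bounded_subset[OF bounded_u[OF z]]) auto
  then obtain x r where r: "strict_mono r" and x: "((\<lambda>n. u (real n)) \<circ> r) \<longlonglongrightarrow> x"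
    using bounded_imp_convergent_subsequence by blast
  have top: "filterlim (\<lambda>n. real (r n)) at_top sequentially"
    using filterlim_compose[OF filterlim_real_sequentially filterlim_subseq[OF r]] .
  have "(\<lambda>n. G (u (real (r n)))) \<longlonglongrightarrow> G x"
    using continuous_on_tendsto_compose[OF cont_G x] by (simp add: o_def)
  moreover have "(\<lambda>n. G (u (real (r n)))) \<longlonglongrightarrow> G z"
    using filterlim_compose[OF G_u_tendsto[OF z] top] .
  ultimately have "G x = G z" by (rule LIMSEQ_unique)
  then have xmin: "x \<in> argmin G" using z by (simp add: mem_argmin_iff)
  obtain l where l: "((\<lambda>t. norm (u t - x)) \<longlongrightarrow> l) at_top"
    using norm_diff_convergent[OF xmin] by blast
  have "(\<lambda>n. norm (u (real (r n)) - x)) \<longlonglongrightarrow> l"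
    using filterlim_compose[OF l top] .
  moreover have "(\<lambda>n. norm (u (real (r n)) - x)) \<longlonglongrightarrow> 0"
    using x by (simp add: o_def tendsto_norm_zero LIM_zero)
  ultimately have "l = 0" by (rule LIMSEQ_unique)
  then have "(u \<longlongrightarrow> x) at_top"
    using l by (simp add: tendsto_norm_zero_iff LIM_zero_iff)
  with xmin show thesis by (rule that)
qed

section \<open>The perturbed energy and the Lojasiewicz estimate\<close>

lemma hessG_u_bounded:
  assumes "argmin G \<noteq> {}"
  obtains M where "M > 0" "\<And>t. t \<ge> 0 \<Longrightarrow> norm (hessG (u t)) \<le> M"
proof -
  obtain z where "z \<in> argmin G" using assms by auto
  then have "compact (closure (u ` {0..}))"
    using bounded_u compact_closure by blast
  then have "bounded (hessG ` closure (u ` {0..}))"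
    by (intro compact_imp_bounded compact_continuous_image continuous_on_subset[OF cont_hess]) auto
  then obtain M where M: "M > 0" "\<And>x. x \<in> closure (u ` {0..}) \<Longrightarrow> norm (hessG x) \<le> M"
    by (auto simp: bounded_pos)
  show thesis
    by (rule that[OF M(1)]) (auto intro!: M(2) subsetD[OF closure_subset])
qed

text \<open>The energy alone dissipates only through the velocity. Differentiating the added product
  creates a negative multiple of the squared gradient norm.\<close>

definition perturbed_energy :: "'a \<Rightarrow> real \<Rightarrow> real \<Rightarrow> real" where
  "perturbed_energy z \<epsilon> t = energy z t + \<epsilon> * (gradG (u t) \<bullet> v t)"

definition perturbed_rate :: "real \<Rightarrow> real \<Rightarrow> real" where
  "perturbed_rate \<epsilon> t = - \<gamma> * (v t \<bullet> v t) +
     \<epsilon> * (gradG (u t) \<bullet> (- (\<gamma> *\<^sub>R v t) - gradG (u t)) + hessG (u t) (v t) \<bullet> v t)"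

lemma perturbed_energy_deriv:
  assumes "t \<ge> 0"
  shows "(perturbed_energy z \<epsilon> has_real_derivative perturbed_rate \<epsilon> t) (at t within {0..})"
  unfolding perturbed_energy_def[abs_def] perturbed_rate_def
  by (intro DERIV_add energy_deriv DERIV_cmult inner_has_real_derivative gradG_u_deriv v_deriv assms)

text \<open>The Hessian term and the mixed term, split by Young's inequality, cost
  \<open>\<epsilon> * (M + \<gamma>\<^sup>2 / 2)\<close> times the squared speed. The choice of
  \<open>\<epsilon>\<close> makes this exactly half of the friction.\<close>

lemma perturbed_rate_le:
  assumes M: "norm (hessG (u t)) \<le> M" and "M > 0" and \<epsilon>: "\<epsilon> = \<gamma> / (2 * M + \<gamma>\<^sup>2)"
  shows "perturbed_rate \<epsilon> t \<le> - (\<gamma> / 2) * (norm (v t))\<^sup>2 - \<epsilon> / 2 * (norm (gradG (u t)))\<^sup>2"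
proof -
  define x where "x = norm (v t)"
  define y where "y = norm (gradG (u t))"
  have pos: "\<epsilon> > 0"
    using \<epsilon> gamma_pos \<open>M > 0\<close> by (simp add: add_pos_pos)
  have balance: "\<epsilon> * M + \<epsilon> * \<gamma>\<^sup>2 / 2 = \<gamma> / 2"
  proof -
    have "2 * M + \<gamma>\<^sup>2 \<noteq> 0" using \<open>M > 0\<close> by (smt (verit) zero_le_power2)
    then have "\<epsilon> * (2 * M + \<gamma>\<^sup>2) = \<gamma>" by (simp add: \<epsilon>)
    then show ?thesis by (simp add: algebra_simps)
  qed
  have "hessG (u t) (v t) \<bullet> v t \<le> norm (hessG (u t) (v t)) * x"
    unfolding x_def by (rule norm_cauchy_schwarz)
  also have "\<dots> \<le> (M * x) * x"
    unfolding x_def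
    by (intro mult_right_mono order_trans[OF norm_blinfun] M) auto
  finally have H: "hessG (u t) (v t) \<bullet> v t \<le> M * x\<^sup>2"
    by (simp add: power2_eq_square mult.assoc)
  have "gradG (u t) \<bullet> (- (\<gamma> *\<^sub>R v t) - gradG (u t)) = - \<gamma> * (gradG (u t) \<bullet> v t) - y\<^sup>2"
    by (simp add: y_def power2_norm_eq_inner inner_diff_right)
  also have "\<dots> \<le> \<gamma> * (y * x) - y\<^sup>2"
    using Cauchy_Schwarz_ineq2[of "gradG (u t)" "v t"] gamma_pos
      mult_left_mono[of "- (gradG (u t) \<bullet> v t)" "y * x" \<gamma>]
    by (simp add: x_def y_def)
  \<comment> \<open>Young's inequality, weighted so that half of the squared gradient norm
    survives.\<close>
  also have "\<gamma> * (y * x) \<le> y\<^sup>2 / 2 + \<gamma>\<^sup>2 / 2 * x\<^sup>2"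
    using zero_le_power2[of "y - \<gamma> * x"] by (simp add: power2_eq_square algebra_simps)
  finally have "gradG (u t) \<bullet> (- (\<gamma> *\<^sub>R v t) - gradG (u t)) + hessG (u t) (v t) \<bullet> v t
      \<le> (M + \<gamma>\<^sup>2 / 2) * x\<^sup>2 - y\<^sup>2 / 2"
    using H by (simp add: algebra_simps)
  then have "perturbed_rate \<epsilon> t \<le> - \<gamma> * x\<^sup>2 + \<epsilon> * ((M + \<gamma>\<^sup>2 / 2) * x\<^sup>2 - y\<^sup>2 / 2)"
    using pos by (simp add: perturbed_rate_def x_def power2_norm_eq_inner)
  also have "\<dots> = - \<gamma> * x\<^sup>2 + (\<epsilon> * M + \<epsilon> * \<gamma>\<^sup>2 / 2) * x\<^sup>2 - \<epsilon> / 2 * y\<^sup>2"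
    by (simp add: algebra_simps)
  also have "\<dots> = - (\<gamma> / 2) * x\<^sup>2 - \<epsilon> / 2 * y\<^sup>2"
    unfolding balance by (simp add: field_simps)
  finally show ?thesis by (simp add: x_def y_def)
qed

lemma gradG_u_tendsto_0:
  assumes z: "z \<in> argmin G" and lim: "(u \<longlongrightarrow> z) at_top"
  shows "((\<lambda>t. gradG (u t)) \<longlongrightarrow> 0) at_top"
  using continuous_on_tendsto_compose[OF cont_gradG lim] gradient_eq_0_of_argmin[OF grad z] by simp

text \<open>The added product has no sign, so nonnegativity is read off from the dynamics: the
  perturbed energy is nonincreasing and tends to 0.\<close>

lemma perturbed_energy_nonneg:
  assumes z: "z \<in> argmin G" and lim: "(u \<longlongrightarrow> z) at_top"
    and rate: "\<And>t. t \<ge> 0 \<Longrightarrow> perturbed_rate \<epsilon> t \<le> 0"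
    and t: "t \<ge> 0"
  shows "0 \<le> perturbed_energy z \<epsilon> t"
proof (rule tendsto_upperbound)
  have "((\<lambda>t. energy z t + \<epsilon> * (gradG (u t) \<bullet> v t)) \<longlongrightarrow> 0 + \<epsilon> * ((0::'a) \<bullet> 0)) at_top"
    by (intro tendsto_add tendsto_mult_left tendsto_inner energy_tendsto_0[OF z]
        gradG_u_tendsto_0[OF z lim] v_tendsto_0[OF z])
  then show "(perturbed_energy z \<epsilon> \<longlongrightarrow> 0) at_top"
    by (simp add: perturbed_energy_def[abs_def])
  show "\<forall>\<^sub>F s in at_top. perturbed_energy z \<epsilon> s \<le> perturbed_energy z \<epsilon> t"
    using eventually_ge_at_top[of t]
    by eventually_elim
      (rule nonincreasing_of_derivative_within[OF perturbed_energy_deriv rate t], auto)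
qed simp

lemma perturbed_energy_le:
  assumes "\<epsilon> \<ge> 0"
  shows "perturbed_energy z \<epsilon> t
    \<le> (1 / 2 + \<epsilon>) * (norm (v t) + norm (gradG (u t)))\<^sup>2 + (G (u t) - G z)"
proof -
  define x where "x = norm (v t)"
  define y where "y = norm (gradG (u t))"
  have nn: "x \<ge> 0" "y \<ge> 0" by (auto simp: x_def y_def)
  have "v t \<bullet> v t = x\<^sup>2" by (simp add: x_def power2_norm_eq_inner)
  moreover have "\<epsilon> * (gradG (u t) \<bullet> v t) \<le> \<epsilon> * (y * x)"
    unfolding x_def y_def by (intro mult_left_mono norm_cauchy_schwarz assms)
  moreover have "x\<^sup>2 \<le> (x + y)\<^sup>2" using nn by (intro power_mono) auto
  moreover have "\<epsilon> * (y * x) \<le> \<epsilon> * (x + y)\<^sup>2"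
  proof (rule mult_left_mono[OF _ assms])
    have "0 \<le> x * y" using nn by simp
    then have "y * x \<le> x\<^sup>2 + y\<^sup>2 + 2 * x * y"
      using zero_le_power2[of x] zero_le_power2[of y] by (simp add: mult.commute)
    then show "y * x \<le> (x + y)\<^sup>2" by (simp add: power2_sum)
  qed
  ultimately show ?thesis
    unfolding perturbed_energy_def energy_def x_def[symmetric] y_def[symmetric]
    by (simp add: algebra_simps)
qed

text \<open>Dissipation is quadratic in a quantity \<open>A\<close> that controls the speed, while
  \<open>Q powr (1 - 1 / q)\<close> is at most linear in \<open>A\<close>. Their quotient, which
  governs the derivative of \<open>Q powr (1 / q)\<close>, is therefore at least linear in
  \<open>A\<close>.\<close>

lemma speed_le_derivative_of_potential:
  assumes z: "z \<in> argmin G" and lim: "(u \<longlongrightarrow> z) at_top"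
    and \<delta>: "\<delta> > 0" and q: "q \<ge> 2" and k: "k > 0"
    and ineq: "\<And>w. w \<in> ball z \<delta> \<Longrightarrow> G w - G z \<le> (k * norm (gradG w)) powr (q / (q - 1))"
  obtains T \<Phi> \<Phi>' where "T \<ge> 0"
    "\<And>t. t \<ge> T \<Longrightarrow> (\<Phi> has_real_derivative \<Phi>' t) (at t within {T..})"
    "\<And>t. t \<ge> T \<Longrightarrow> norm (v t) + norm (- (\<gamma> *\<^sub>R v t) - gradG (u t)) \<le> - \<Phi>' t"
    "\<And>t. t \<ge> T \<Longrightarrow> 0 \<le> \<Phi> t"
proof -
  obtain M where M: "M > 0" "\<And>t. t \<ge> 0 \<Longrightarrow> norm (hessG (u t)) \<le> M"
    using hessG_u_bounded z by blast
  define \<epsilon> where "\<epsilon> = \<gamma> / (2 * M + \<gamma>\<^sup>2)"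
  have \<epsilon>: "\<epsilon> > 0"
    using gamma_pos M(1) by (simp add: \<epsilon>_def add_pos_pos)
  \<comment> \<open>One rate below the coefficients of all three dissipated squares: velocity,
    gradient and \<open>B t\<close>, the last with coefficient 1.\<close>
  define b where "b = min (min (\<gamma> / 2) (\<epsilon> / 2)) 1"
  have b: "0 < b" "b \<le> \<gamma> / 2" "b \<le> \<epsilon> / 2" "b \<le> 1"
    using gamma_pos \<epsilon> by (auto simp: b_def)
  \<comment> \<open>The conjugate exponent of \<open>q\<close>. Since \<open>p \<le> 2\<close>,
    squares of numbers below 1 are bounded by their \<open>p\<close>-th powers.\<close>
  define p where "p = q / (q - 1)"
  have p: "1 \<le> p" "p \<le> 2" "1 - 1 / q = 1 / p"
    using q by (auto simp: p_def field_simps)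
  define x where "x t = norm (v t)" for t
  define y where "y t = norm (gradG (u t))" for t
  \<comment> \<open>The square root of the correction \<open>exp (- t)\<close>, so that it enters
    \<open>A\<close> on the same footing as the two norms.\<close>
  define B where "B t = exp (- t / 2)" for t :: real
  define A where "A t = x t + y t + B t" for t
  have nn: "0 \<le> x t" "0 \<le> y t" "0 < B t" for t
    by (auto simp: x_def y_def B_def)
  have A_pos: "0 < A t" for t
    using nn[of t] by (simp add: A_def)
  \<comment> \<open>The exponential term keeps \<open>Q\<close> positive even if the motion stops in finite time, so
    that \<open>Q powr (1 / q)\<close> is differentiable.\<close>
  define Q where "Q t = perturbed_energy z \<epsilon> t + exp (- t)" for t
  define Q' where "Q' t = perturbed_rate \<epsilon> t - exp (- t)" for t
  have exp_B: "exp (- t) = (B t)\<^sup>2" for t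
    by (simp add: B_def power2_eq_square flip: exp_add)
  have rate: "perturbed_rate \<epsilon> t \<le> - (\<gamma> / 2) * (x t)\<^sup>2 - \<epsilon> / 2 * (y t)\<^sup>2" if "t \<ge> 0" for t
    unfolding x_def y_def by (rule perturbed_rate_le[OF M(2)[OF that] M(1) \<epsilon>_def])
  have Q_pos: "0 < Q t" if "t \<ge> 0" for t
  proof -
    have "perturbed_rate \<epsilon> s \<le> 0" if "s \<ge> 0" for s
      using rate[OF that] gamma_pos \<epsilon>
        mult_nonneg_nonneg[of "\<gamma> / 2" "(x s)\<^sup>2"] mult_nonneg_nonneg[of "\<epsilon> / 2" "(y s)\<^sup>2"]
        zero_le_power2[of "x s"] zero_le_power2[of "y s"]
      by linarith
    then show ?thesis
      using perturbed_energy_nonneg[OF z lim _ that] by (simp add: Q_def add_nonneg_pos)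
  qed
  have Q_deriv: "(Q has_real_derivative Q' t) (at t within {0..})" if "t \<ge> 0" for t
    unfolding Q_def[abs_def] Q'_def
    by (rule DERIV_cong[OF DERIV_add[OF perturbed_energy_deriv[OF that]]])
      (auto intro!: derivative_eq_intros)
  have Q'_le: "Q' t \<le> - (b / 3) * (A t)\<^sup>2" if "t \<ge> 0" for t
  proof -
    have "(A t)\<^sup>2 \<le> 3 * ((x t)\<^sup>2 + (y t)\<^sup>2 + (B t)\<^sup>2)"
      using zero_le_power2[of "x t - y t"] zero_le_power2[of "y t - B t"]
        zero_le_power2[of "x t - B t"]
      by (simp add: A_def power2_eq_square algebra_simps)
    then have "b / 3 * (A t)\<^sup>2 \<le> b * (x t)\<^sup>2 + b * (y t)\<^sup>2 + b * (B t)\<^sup>2"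
      using mult_left_mono[of "(A t)\<^sup>2" _ "b / 3"] b(1) by (fastforce simp: algebra_simps)
    also have "\<dots> \<le> \<gamma> / 2 * (x t)\<^sup>2 + \<epsilon> / 2 * (y t)\<^sup>2 + 1 * (B t)\<^sup>2"
      by (intro add_mono mult_right_mono b) auto
    finally show ?thesis
      using rate[OF that] by (simp add: Q'_def exp_B)
  qed
  have "(A \<longlongrightarrow> 0) at_top"
  proof -
    have "filterlim (\<lambda>t. 1 / 2 * t :: real) at_top at_top"
      by (rule filterlim_tendsto_pos_mult_at_top[OF tendsto_const _ filterlim_ident]) simp
    then have "(B \<longlongrightarrow> 0) at_top"
      unfolding B_def by (intro filterlim_compose[OF exp_at_bot]) (simp add: filterlim_uminus_at_bot)
    then have "((\<lambda>t. x t + y t + B t) \<longlongrightarrow> 0 + 0 + 0) at_top"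
      unfolding x_def y_def
      by (intro tendsto_add tendsto_norm_zero v_tendsto_0[OF z] gradG_u_tendsto_0[OF z lim])
    then show ?thesis by (simp add: A_def[abs_def])
  qed
  then have "\<forall>\<^sub>F t in at_top. A t < 1"
    by (rule order_tendstoD) simp
  moreover have "\<forall>\<^sub>F t in at_top. u t \<in> ball z \<delta>"
    using tendstoD[OF lim \<delta>] by (simp add: dist_commute)
  ultimately have "\<forall>\<^sub>F t in at_top. A t < 1 \<and> u t \<in> ball z \<delta> \<and> t \<ge> 0"
    using eventually_ge_at_top[of 0] by eventually_elim auto
  then obtain T where T: "\<And>t. t \<ge> T \<Longrightarrow> A t < 1" "\<And>t. t \<ge> T \<Longrightarrow> u t \<in> ball z \<delta>" "T \<ge> 0"
    by (auto simp: eventually_at_top_linorder)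
  \<comment> \<open>Here \<open>1 / 2 + \<epsilon>\<close> comes from the kinetic and mixed terms, 1
    from \<open>exp (- t)\<close>, and \<open>k powr p\<close> from the gradient inequality.\<close>
  define C where "C = 3 / 2 + \<epsilon> + k powr p"
  have C: "C > 0" using \<epsilon> by (simp add: C_def add_pos_nonneg)
  have Q_le: "Q t \<le> C * A t powr p" if "t \<ge> T" for t
  proof -
    have sq: "(A t)\<^sup>2 \<le> A t powr p"
      using powr_mono'[OF p(2), of "A t"] A_pos[of t] T(1)[OF that] by (simp add: powr_numeral)
    have "G (u t) - G z \<le> (k * y t) powr p"
      using ineq[OF T(2)[OF that]] by (simp add: y_def p_def)
    also have "\<dots> \<le> (k * A t) powr p"
      using k nn[of t] p by (intro powr_mono2 mult_left_mono) (auto simp: A_def)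
    also have "\<dots> = k powr p * A t powr p"
      using k A_pos[of t] by (simp add: powr_mult)
    finally have F: "G (u t) - G z \<le> k powr p * A t powr p" .
    have "(x t + y t)\<^sup>2 \<le> (A t)\<^sup>2"
      using nn[of t] by (intro power_mono) (auto simp: A_def)
    then have "(1 / 2 + \<epsilon>) * (x t + y t)\<^sup>2 \<le> (1 / 2 + \<epsilon>) * A t powr p"
      using sq \<epsilon> by (intro mult_left_mono) auto
    moreover have "exp (- t) \<le> A t powr p"
      unfolding exp_B using nn[of t] by (intro order_trans[OF power_mono sq]) (auto simp: A_def)
    moreover have "perturbed_energy z \<epsilon> t \<le> (1 / 2 + \<epsilon>) * (x t + y t)\<^sup>2 + (G (u t) - G z)"
      unfolding x_def y_def using \<epsilon> by (intro perturbed_energy_le) simp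
    ultimately show ?thesis
      using F unfolding Q_def C_def by (simp add: algebra_simps)
  qed
  define D where "D = C powr (1 / p)"
  have D: "D > 0" using C by (simp add: D_def)
  \<comment> \<open>Chosen so that \<open>K * (1 / q) * (b / 3) / D\<close> equals
    \<open>1 + \<gamma>\<close>, the factor by which \<open>A\<close> must be multiplied to dominate
    the speed of \<open>(u, v)\<close>.\<close>
  define K where "K = 3 * D * q * (1 + \<gamma>) / b"
  have K: "K > 0" using D q gamma_pos b(1) by (simp add: K_def)
  define \<Phi> where "\<Phi> t = K * Q t powr (1 / q)" for t
  define \<Phi>' where "\<Phi>' t = K * (1 / q * Q t powr (1 / q - 1) * Q' t)" for t
  show thesis
  proof (rule that)
    show "T \<ge> 0" by (rule T(3))
    fix t assume t: "t \<ge> T"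
    then have t0: "t \<ge> 0" using T(3) by simp
    show "0 \<le> \<Phi> t" using K by (simp add: \<Phi>_def)
    show "(\<Phi> has_real_derivative \<Phi>' t) (at t within {T..})"
      unfolding \<Phi>_def[abs_def] \<Phi>'_def
      by (intro DERIV_cmult DERIV_chain2[where g = Q] has_real_derivative_powr Q_pos t0
          DERIV_subset[OF Q_deriv[OF t0]]) (use T(3) in auto)
    have "Q t powr (1 / p) \<le> (C * A t powr p) powr (1 / p)"
      using Q_le[OF t] Q_pos[OF t0] p by (intro powr_mono2) auto
    also have "\<dots> = D * A t"
      using C A_pos[of t] p by (simp add: D_def powr_mult powr_powr)
    finally have root: "Q t powr (1 / p) \<le> D * A t" .
    \<comment> \<open>Dividing the quadratic dissipation by the linear bound \<open>D * A t\<close>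
      leaves a linear lower bound.\<close>
    have "A t / D = (A t)\<^sup>2 / (D * A t)"
      using A_pos[of t] by (simp add: power2_eq_square)
    also have "\<dots> \<le> (A t)\<^sup>2 / Q t powr (1 / p)"
      using root Q_pos[OF t0] A_pos[of t] D by (intro divide_left_mono) auto
    also have "\<dots> = Q t powr (1 / q - 1) * (A t)\<^sup>2"
    proof -
      have "1 / q - 1 = - (1 / p)" using p(3) by linarith
      then show ?thesis by (simp only: powr_minus) (simp add: divide_inverse)
    qed
    finally have "K * (1 / q) * (b / 3) * (A t / D) \<le> K * (1 / q) * (b / 3) * (Q t powr (1 / q - 1) * (A t)\<^sup>2)"
      using K q b(1) by (intro mult_left_mono) auto
    also have "\<dots> = K * (1 / q) * Q t powr (1 / q - 1) * (b / 3 * (A t)\<^sup>2)"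
      by simp
    also have "\<dots> \<le> K * (1 / q) * Q t powr (1 / q - 1) * (- Q' t)"
      using K q Q'_le[OF t0] by (intro mult_left_mono) auto
    also have "\<dots> = - \<Phi>' t" by (simp add: \<Phi>'_def)
    also have "K * (1 / q) * (b / 3) * (A t / D) = (1 + \<gamma>) * A t"
      using D q b(1) by (simp add: K_def)
    finally have "(1 + \<gamma>) * A t \<le> - \<Phi>' t" .
    moreover have "norm (- (\<gamma> *\<^sub>R v t) - gradG (u t)) \<le> \<gamma> * x t + y t"
      using norm_triangle_ineq4[of "- (\<gamma> *\<^sub>R v t)" "gradG (u t)"] gamma_pos by (simp add: x_def y_def)
    moreover have "x t + (\<gamma> * x t + y t) \<le> (1 + \<gamma>) * A t"
      using nn[of t] gamma_pos mult_nonneg_nonneg[of \<gamma> "y t"] mult_nonneg_nonneg[of \<gamma> "B t"]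
      by (simp add: A_def algebra_simps)
    ultimately show "norm (v t) + norm (- (\<gamma> *\<^sub>R v t) - gradG (u t)) \<le> - \<Phi>' t"
      by (simp add: x_def)
  qed
qed

section \<open>Finite length of the phase curve\<close>

lemma state_deriv:
  assumes "t \<ge> 0"
  shows "((\<lambda>t. (u t, v t)) has_vector_derivative (v t, - (\<gamma> *\<^sub>R v t) - gradG (u t)))
    (at t within {0..})"
  by (intro has_vector_derivative_Pair u_deriv v_deriv assms)

text \<open>Controls the initial piece of the curve: its velocity is continuous, hence bounded on a
  compact interval.\<close>

lemma state_lipschitz_on_interval:
  obtains L where "L \<ge> 0"
    "\<And>s t. 0 \<le> s \<Longrightarrow> s \<le> t \<Longrightarrow> t \<le> T \<Longrightarrow> dist (u s, v s) (u t, v t) \<le> L * (t - s)"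
proof -
  let ?f' = "\<lambda>t. (v t, - (\<gamma> *\<^sub>R v t) - gradG (u t))"
  have "continuous_on {0..T} ?f'"
    by (intro continuous_intros continuous_on_compose2[OF cont_gradG]
        continuous_on_subset[OF cont_u] continuous_on_subset[OF cont_v]) auto
  then have "bounded (?f' ` {0..T})"
    by (intro compact_imp_bounded compact_continuous_image) auto
  then obtain L where L: "L > 0" "\<And>t. t \<in> {0..T} \<Longrightarrow> norm (?f' t) \<le> L"
    by (auto simp: bounded_pos)
  show thesis
  proof
    show "L \<ge> 0" using L(1) by simp
    fix s t :: real assume st: "0 \<le> s" "s \<le> t" "t \<le> T"
    have "norm ((u t, v t) - (u s, v s)) \<le> L * t - L * s"
    proof (rule norm_diff_le_of_derivative_within[where f = "\<lambda>t. (u t, v t)" and \<phi> = "\<lambda>t. L * t"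
          and a = 0 and \<phi>' = "\<lambda>_. L"])
      show "norm (?f' x) \<le> L" if "s < x" "x < t" for x
        using that st by (intro L) auto
    qed (use st in \<open>auto intro!: state_deriv derivative_eq_intros\<close>)
    then show "dist (u s, v s) (u t, v t) \<le> L * (t - s)"
      by (simp add: dist_norm norm_minus_commute algebra_simps flip: diff_Pair)
  qed
qed

lemma curve_length_state_finite:
  assumes z: "z \<in> argmin G" and lim: "(u \<longlongrightarrow> z) at_top"
    and pos: "\<eta> > 0" "c > 0"
    and growth: "\<And>w. w \<in> ball z \<eta> \<Longrightarrow> G w \<ge> G z + c * infdist w (argmin G) powr r"
  shows "curve_length {0..} (\<lambda>t. (u t, v t)) < \<infinity>"
proof -
  obtain \<delta> q k where "\<delta> > 0" "q \<ge> 2" "k > 0"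
    "\<And>w. w \<in> ball z \<delta> \<Longrightarrow> G w - G z \<le> (k * norm (gradG w)) powr (q / (q - 1))"
    using growth_imp_gradient_inequality[OF conv grad z pos growth] by blast
  then obtain T \<Phi> \<Phi>' where T: "T \<ge> 0"
    and \<Phi>: "\<And>t. t \<ge> T \<Longrightarrow> (\<Phi> has_real_derivative \<Phi>' t) (at t within {T..})"
    and speed: "\<And>t. t \<ge> T \<Longrightarrow> norm (v t) + norm (- (\<gamma> *\<^sub>R v t) - gradG (u t)) \<le> - \<Phi>' t"
    and \<Phi>_nonneg: "\<And>t. t \<ge> T \<Longrightarrow> 0 \<le> \<Phi> t"
    using speed_le_derivative_of_potential[OF z lim] by blast
  obtain L where L: "L \<ge> 0"
    "\<And>s t. 0 \<le> s \<Longrightarrow> s \<le> t \<Longrightarrow> t \<le> T \<Longrightarrow> dist (u s, v s) (u t, v t) \<le> L * (t - s)"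
    using state_lipschitz_on_interval[of T] by blast
  have tail: "dist (u s, v s) (u t, v t) \<le> \<Phi> s - \<Phi> t" if "T \<le> s" "s \<le> t" for s t
  proof -
    have "norm ((u t, v t) - (u s, v s)) \<le> - \<Phi> t - - \<Phi> s"
    proof (rule norm_diff_le_of_derivative_within[where f = "\<lambda>t. (u t, v t)" and \<phi> = "\<lambda>t. - \<Phi> t"
          and a = T and \<phi>' = "\<lambda>t. - \<Phi>' t"])
      show "((\<lambda>t. (u t, v t)) has_vector_derivative (v r, - (\<gamma> *\<^sub>R v r) - gradG (u r)))
          (at r within {T..})" if "T \<le> r" for r
        using T that by (intro has_vector_derivative_within_subset[OF state_deriv]) auto
      show "((\<lambda>t. - \<Phi> t) has_real_derivative - \<Phi>' r) (at r within {T..})" if "T \<le> r" for r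
        by (intro DERIV_minus \<Phi> that)
      show "norm (v r, - (\<gamma> *\<^sub>R v r) - gradG (u r)) \<le> - \<Phi>' r" if "s < r" for r
        using that \<open>T \<le> s\<close> by (intro order_trans[OF norm_Pair_le speed]) auto
    qed (use that in auto)
    then show ?thesis by (simp add: dist_norm norm_minus_commute flip: diff_Pair)
  qed
  \<comment> \<open>A majorant of arc length: Lipschitz growth up to \<open>T\<close>, then the drop
    of the potential. The two branches agree at \<open>T\<close>, and \<open>\<Phi> \<ge> 0\<close>
    bounds the second.\<close>
  define V where "V t = (if t \<le> T then L * t else L * T + \<Phi> T - \<Phi> t)" for t
  have "curve_length {0..} (\<lambda>t. (u t, v t)) \<le> ennreal (L * T + \<Phi> T - 0)"
  proof (rule curve_length_le[where V = V])
    fix s t :: real assume st: "s \<in> {0..}" "s \<le> t"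
    consider "t \<le> T" | "s \<le> T" "T < t" | "T < s" using st by linarith
    then show "dist (u s, v s) (u t, v t) \<le> V t - V s"
    proof cases
      case 1
      then show ?thesis using L(2)[of s t] st by (simp add: V_def algebra_simps)
    next
      case 2
      have "dist (u s, v s) (u t, v t) \<le> dist (u s, v s) (u T, v T) + dist (u T, v T) (u t, v t)"
        by (rule dist_triangle)
      then show ?thesis
        using 2 L(2)[of s T] tail[of T t] st by (simp add: V_def algebra_simps)
    next
      case 3
      then show ?thesis using tail[of s t] st by (simp add: V_def)
    qed
  next
    fix t :: real assume t: "t \<in> {0..}"
    have "\<Phi> t \<le> \<Phi> T" if "t \<ge> T"
      using tail[of T t] that zero_le_dist[of "(u T, v T)" "(u t, v t)"] by linarith
    moreover have "0 \<le> L * T"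
      using L(1) T by simp
    ultimately show "0 \<le> V t"
      using t L(1) by (auto simp: V_def)
    show "V t \<le> L * T + \<Phi> T"
      using \<Phi>_nonneg[of t] \<Phi>_nonneg[of T] L(1) mult_left_mono[of t T L] by (auto simp: V_def)
  qed
  then show ?thesis
    by (rule le_less_trans) simp
qed

end

theorem corollary5p5:
  fixes \<gamma> :: real
    and G :: "real ^ 'n \<Rightarrow> real"
    and gradG :: "real ^ 'n \<Rightarrow> real ^ 'n"
    and hessG :: "real ^ 'n \<Rightarrow> ((real ^ 'n) \<Rightarrow>\<^sub>L (real ^ 'n))"
    and u u' u'' :: "real \<Rightarrow> real ^ 'n"
  assumes gamma_pos: "\<gamma> > 0"
    and G_grad: "\<And>x. GDERIV G x :> gradG x"
    and G_hess: "\<And>x. (gradG has_derivative blinfun_apply (hessG x)) (at x)"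
    and G_C2: "continuous_on UNIV hessG"
    and G_convex: "convex_on UNIV G"
    and argmin_nonempty: "argmin G \<noteq> {}"
    and growth: "\<forall>xstar\<in>argmin G. \<exists>\<eta>>0. \<exists>r\<ge>1. \<exists>c>0. \<forall>w\<in>ball xstar \<eta>.
                   G w \<ge> G xstar + c * infdist w (argmin G) powr r"
    and u_deriv: "\<And>t. t \<ge> 0 \<Longrightarrow> (u has_vector_derivative u' t) (at t within {0..})"
    and u_deriv2: "\<And>t. t \<ge> 0 \<Longrightarrow> (u' has_vector_derivative u'' t) (at t within {0..})"
    and u_C2: "continuous_on {0..} u''"
    and ode: "\<And>t. t \<ge> 0 \<Longrightarrow> u'' t + \<gamma> *\<^sub>R u' t + gradG (u t) = 0"
  shows "curve_length {0..} (\<lambda>t. (u t, u' t)) < \<infinity> \<and>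
         (\<exists>uinf\<in>argmin G. (u \<longlongrightarrow> uinf) at_top)"
proof -
  have accel: "u'' t = - (\<gamma> *\<^sub>R u' t) - gradG (u t)" if "t \<ge> 0" for t
    using ode[OF that] by (simp add: algebra_simps eq_neg_iff_add_eq_0)
  interpret damped_gradient_flow \<gamma> G gradG hessG u u'
    using gamma_pos G_grad G_hess G_C2 G_convex u_deriv u_deriv2 accel
    by unfold_locales auto
  obtain z where z: "z \<in> argmin G" "(u \<longlongrightarrow> z) at_top"
    using u_tendsto_argmin[OF argmin_nonempty] by blast
  \<comment> \<open>Growth is invoked at the limit of \<open>u\<close>, whose neighborhood
    eventually contains the trajectory.\<close>
  obtain \<eta> r c where "\<eta> > 0" "c > 0"
    "\<And>w. w \<in> ball z \<eta> \<Longrightarrow> G w \<ge> G z + c * infdist w (argmin G) powr r"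
    using growth z(1) by blast
  then have "curve_length {0..} (\<lambda>t. (u t, u' t)) < \<infinity>"
    by (rule curve_length_state_finite[OF z])
  with z show ?thesis by blast
qed

end
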